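(* Let $L_\ell$ be a closed straight line segment of length $\ell>0$ (with the usual metric). If $(X^k)_{k=1}^\infty$ is a sequence of finite subsets of $L_\ell$ which converges to $L_\ell$ in the Hausdorff metric, then the sequence of magnitudes converges: \[|X^k|\to \ell/2+1\quad\text{as }k\to\infty.\]
   Context: A weighting on a finite metric space $(X,d)$ is a choice of real number $w_x$ for each $x\in X$ such that $\sum_{x'\in X} e^{-d(x,x')}w_{x'}=1$ for every $x\in X$. If a weighting exists, the magnitude of $X$ is $|X| := \sum_{x\in X} w_x$; this is independent of the choice of weighting. Every finite subset of $\mathbb R$, with the subspace metric, has a well-defined magnitude. The Hausdorff distance between compact subsets $X',X''$ of a metric space $X$ is $\inf\{\epsilon\ge 0 : X'\subseteq E(X'',\epsilon)\text{ and }X''\subseteq E(X',\epsilon)\}$ (with $\inf\emptyset=\infty$), where $E(X',\epsilon)$ is the set of points of $X$ at distance at most $\epsilon$ from some point of $X'$. *)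

theory Defs
  imports "HOL-Analysis.Analysis"
begin

(* The finite metric space is the set A with the metric of its ambient type;
   values of w outside A are irrelevant. *)
definition is_weighting :: "'a::metric_space set \<Rightarrow> ('a \<Rightarrow> real) \<Rightarrow> bool" where
  "is_weighting A w \<longleftrightarrow> (\<forall>x\<in>A. (\<Sum>x'\<in>A. exp (- dist x x') * w x') = 1)"

(* Meaningful only when A is finite and has a weighting; the sum is then independent of
   the choice of weighting, so the description is unique.  Otherwise the value is unspecified. *)
definition magnitude :: "'a::metric_space set \<Rightarrow> real" where
  "magnitude A = (THE m. \<exists>w. is_weighting A w \<and> m = (\<Sum>x\<in>A. w x))"

definition closed_nbhd :: "'a::metric_space set \<Rightarrow> 'a set \<Rightarrow> real \<Rightarrow> 'a set" where
  "closed_nbhd S A \<epsilon> = {x\<in>S. \<exists>y\<in>A. dist x y \<le> \<epsilon>}"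

(* Distance of subsets A, B of the metric space S.  The infimum is taken in ereal, so that
   it is \<infinity> when no \<epsilon> qualifies, as happens when exactly one of A, B is empty. *)
definition hausdorff_dist :: "'a::metric_space set \<Rightarrow> 'a set \<Rightarrow> 'a set \<Rightarrow> ereal" where
  "hausdorff_dist S A B =
     Inf (ereal ` {\<epsilon>. 0 \<le> \<epsilon> \<and> A \<subseteq> closed_nbhd S B \<epsilon> \<and> B \<subseteq> closed_nbhd S A \<epsilon>})"

end

(* Adding a point x to the right of a finite set A of reals, at distance d from its maximum,
   increases the magnitude by exactly tanh (d/2).  As d/2 * (1 - d) <= tanh (d/2) <= d/2, a set
   all of whose gaps are at most r has magnitude within r * (Max - Min) / 2 of 1 + (Max - Min) / 2.
   A segment is isometric to a real interval through the distance to its endpoint a, and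
   Hausdorff convergence forces the gaps to 0 and Max - Min to l. *)
theory Submission
  imports Defs
begin

text \<open>The kernel \<open>exp (- dist x y)\<close> is symmetric, so pairing two weightings
  through it and swapping the double sum gives both totals. This uniqueness discharges the
  description in \<open>magnitude\<close>.\<close>

lemma magnitude_eqI:
  assumes "is_weighting A w"
  shows "magnitude A = (\<Sum>x\<in>A. w x)"
proof -
  have "(\<Sum>x\<in>A. v x) = (\<Sum>x\<in>A. w x)" if "is_weighting A v" for v
  proof -
    have "(\<Sum>x\<in>A. v x) = (\<Sum>x\<in>A. v x * (\<Sum>y\<in>A. exp (- dist x y) * w y))"
      using assms by (simp add: is_weighting_def)
    also have "\<dots> = (\<Sum>y\<in>A. \<Sum>x\<in>A. v x * (exp (- dist x y) * w y))"
      unfolding sum_distrib_left by (rule sum.swap)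
    also have "\<dots> = (\<Sum>y\<in>A. w y * (\<Sum>x\<in>A. exp (- dist y x) * v x))"
      unfolding sum_distrib_left by (intro sum.cong refl) (simp add: dist_commute)
    also have "\<dots> = (\<Sum>y\<in>A. w y)"
      using that by (simp add: is_weighting_def)
    finally show ?thesis .
  qed
  then show ?thesis
    unfolding magnitude_def using assms by (intro the_equality) blast+
qed

lemma is_weighting_isometry:
  assumes "\<And>x y. x \<in> A \<Longrightarrow> y \<in> A \<Longrightarrow> dist (f x) (f y) = dist x y"
  shows "is_weighting (f ` A) w \<longleftrightarrow> is_weighting A (w \<circ> f)"
    and "(\<Sum>x\<in>f ` A. w x) = (\<Sum>x\<in>A. (w \<circ> f) x)"
proof -
  have inj: "inj_on f A"
    using assms by (metis dist_eq_0_iff inj_onI)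
  then show "(\<Sum>x\<in>f ` A. w x) = (\<Sum>x\<in>A. (w \<circ> f) x)"
    by (rule sum.reindex)
  show "is_weighting (f ` A) w \<longleftrightarrow> is_weighting A (w \<circ> f)"
    using assms by (simp add: is_weighting_def sum.reindex[OF inj])
qed

text \<open>Upper bound: \<open>x - tanh x\<close> has derivative \<open>(tanh x)\<^sup>2\<close>.
  Lower bound: \<open>tanh (d / 2)\<close> equals \<open>(1 - q) / (1 + q)\<close> for
  \<open>q = exp (- d)\<close>, which decreases in \<open>q\<close>, and \<open>q\<close> is at most
  \<open>1 / (1 + d)\<close>. The error is quadratic in \<open>d\<close>, so it stays small when
  summed over many short gaps.\<close>

lemma tanh_half_bounds:
  fixes d :: real
  assumes "0 \<le> d"
  shows "d / 2 * (1 - d) \<le> tanh (d / 2)" and "tanh (d / 2) \<le> d / 2"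
proof -
  have "0 - tanh 0 \<le> d / 2 - tanh (d / 2)"
  proof (rule DERIV_nonneg_imp_nondecreasing[where f = "\<lambda>x. x - tanh x"])
    show "\<exists>y. ((\<lambda>x. x - tanh x) has_real_derivative y) (at x) \<and> 0 \<le> y"
      if "0 \<le> x" for x :: real
      by (rule exI[of _ "(tanh x)\<^sup>2"]) (auto intro!: derivative_eq_intros)
  qed (use assms in auto)
  then show "tanh (d / 2) \<le> d / 2" by simp
  define q where "q = exp (- d)"
  have q: "0 < q" "q * (1 + d) \<le> 1"
    using exp_ge_add_one_self[of d] by (auto simp: q_def exp_minus field_simps)
  have "d / 2 * (1 - d) \<le> d / (2 + d)"
    using assms by (simp add: field_simps)
  also have "\<dots> \<le> (1 - q) / (1 + q)"
    using q assms by (simp add: field_simps)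
  also have "\<dots> = tanh (d / 2)"
    by (simp add: tanh_real_altdef q_def)
  finally show "d / 2 * (1 - d) \<le> tanh (d / 2)" .
qed

text \<open>On the line, every distance from \<open>x\<close> to a point of \<open>A\<close> passes
  through the maximum of \<open>A\<close>. Hence the kernel row of \<open>x\<close> is a multiple of
  the row of that maximum, and only these two weights have to be adjusted.\<close>

lemma weighting_insert_max:
  fixes A :: "real set"
  assumes "finite A" "A \<noteq> {}" "Max A < x" and w: "is_weighting A w"
  obtains w' where "is_weighting (insert x A) w'"
    and "(\<Sum>y\<in>insert x A. w' y) = (\<Sum>y\<in>A. w y) + tanh ((x - Max A) / 2)"
proof -
  define m q where "m = Max A" and "q = exp (- (x - m))"
  \<comment> \<open>\<open>c\<close> solves \<open>q + (1 - q * q) * c = 1\<close>, the weighting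
    equation at \<open>x\<close>. Subtracting \<open>q * c\<close> at \<open>m\<close> cancels the
    effect of \<open>x\<close> on the equations at the old points.\<close>
  define c where "c = 1 / (1 + q)"
  define w' where "w' = (\<lambda>y. if y = x then c else if y = m then w y - q * c else w y)"
  have m: "m \<in> A" "m < x" "\<And>y. y \<in> A \<Longrightarrow> y \<le> m"
    using assms by (auto simp: m_def)
  then have "x \<notin> A" by force
  have q: "0 < q" by (simp add: q_def)
  \<comment> \<open>With \<open>g\<close> a kernel row this yields the weighting equations; with
    \<open>g\<close> constantly 1 it yields the total, where \<open>(1 - q) * c\<close> is the
    \<open>tanh\<close> term.\<close>
  have sum_w': "(\<Sum>y\<in>insert x A. g y * w' y) = (\<Sum>y\<in>A. g y * w y) + (g x - q * g m) * c"
    for g :: "real \<Rightarrow> real"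
  proof -
    have "(\<Sum>y\<in>A. g y * w' y) = (\<Sum>y\<in>A. g y * w y - (if y = m then g m * q * c else 0))"
      using \<open>x \<notin> A\<close> by (intro sum.cong refl) (auto simp: w'_def algebra_simps)
    also have "\<dots> = (\<Sum>y\<in>A. g y * w y) - g m * q * c"
      using \<open>finite A\<close> m by (simp add: sum_subtractf)
    finally show ?thesis
      using \<open>finite A\<close> \<open>x \<notin> A\<close> by (simp add: w'_def algebra_simps)
  qed
  have "is_weighting (insert x A) w'"
    unfolding is_weighting_def
  proof
    fix z assume "z \<in> insert x A"
    show "(\<Sum>y\<in>insert x A. exp (- dist z y) * w' y) = 1"
    proof (cases "z = x")
      case True
      have "(\<Sum>y\<in>A. exp (- dist x y) * w y) = (\<Sum>y\<in>A. q * (exp (- dist m y) * w y))"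
        using m by (intro sum.cong refl) (force simp: q_def dist_real_def simp flip: exp_add)
      also have "\<dots> = q"
        using w m by (simp add: is_weighting_def flip: sum_distrib_left)
      finally have "(\<Sum>y\<in>insert x A. exp (- dist z y) * w' y) = q + (1 - q * q) * c"
        unfolding sum_w' using True m by (simp add: dist_real_def q_def)
      also have "\<dots> = 1"
        using q by (simp add: c_def field_simps)
      finally show ?thesis .
    next
      case False
      then have z: "z \<in> A" using \<open>z \<in> insert x A\<close> by simp
      have "exp (- dist z x) = q * exp (- dist z m)"
        using m(2) m(3)[OF z] by (simp add: q_def dist_real_def flip: exp_add)
      then show ?thesis
        unfolding sum_w' using w z by (simp add: is_weighting_def)
    qed
  qed
  moreover have "(\<Sum>y\<in>insert x A. w' y) = (\<Sum>y\<in>A. w y) + tanh ((x - m) / 2)"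
    using sum_w'[of "\<lambda>_. 1"] by (simp add: tanh_real_altdef c_def q_def diff_divide_distrib)
  ultimately show ?thesis
    using that by (simp add: m_def)
qed

text \<open>Building \<open>A\<close> from left to right, the total is 1 plus a \<open>tanh\<close>
  term per gap, and the gaps telescope to \<open>Max A - Min A\<close>. The hypothesis bounds each
  gap by \<open>r\<close>.\<close>

lemma weighting_bounds:
  fixes A :: "real set"
  assumes "finite A" "A \<noteq> {}"
    and "\<And>x. x \<in> A \<Longrightarrow> x \<noteq> Min A \<Longrightarrow> \<exists>y\<in>A. x - r \<le> y \<and> y < x"
  shows "\<exists>w. is_weighting A w \<and> (\<Sum>x\<in>A. w x) \<le> 1 + (Max A - Min A) / 2 \<and>
    1 + (Max A - Min A) / 2 * (1 - r) \<le> (\<Sum>x\<in>A. w x)"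
  using assms
proof (induction A rule: finite_linorder_max_induct)
  case empty
  then show ?case by simp
next
  case (insert x A)
  show ?case
  proof (cases "A = {}")
    case True
    then show ?thesis
      by (intro exI[of _ "\<lambda>_. 1"]) (simp add: is_weighting_def)
  next
    case False
    define m where "m = Max A"
    have m: "m \<in> A" "m < x" "\<And>y. y \<in> A \<Longrightarrow> y \<le> m"
      using insert.hyps False by (auto simp: m_def)
    have Min_le: "Min A \<le> m"
      using insert.hyps m by simp
    have eqs: "Max (insert x A) = x" "Min (insert x A) = Min A"
      using insert.hyps(1) False Min_le m by (auto simp: max_def min_def simp flip: m_def)
    \<comment> \<open>A witness below \<open>z\<close> cannot be the new point \<open>x\<close>,
      which exceeds all of \<open>A\<close>.\<close>
    have "\<exists>y\<in>A. z - r \<le> y \<and> y < z" if "z \<in> A" "z \<noteq> Min A" for z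
      using insert.prems(2)[of z] that insert.hyps(2) eqs(2) by force
    then obtain w where w: "is_weighting A w" "(\<Sum>x\<in>A. w x) \<le> 1 + (m - Min A) / 2"
        "1 + (m - Min A) / 2 * (1 - r) \<le> (\<Sum>x\<in>A. w x)"
      using insert.IH False by (auto simp: m_def)
    have "x - m \<le> r"
      using insert.prems(2)[of x] eqs(2) Min_le m by force
    obtain w' where w': "is_weighting (insert x A) w'"
        "(\<Sum>y\<in>insert x A. w' y) = (\<Sum>y\<in>A. w y) + tanh ((x - m) / 2)"
      using weighting_insert_max[OF insert.hyps(1) False _ w(1)] m(2) by (auto simp: m_def)
    \<comment> \<open>Trading the individual gap for \<open>r\<close> gives all gaps the common
      factor \<open>1 - r\<close>, so that the lower bounds add up.\<close>
    have "(x - m) / 2 * (1 - r) \<le> (x - m) / 2 * (1 - (x - m))"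
      using m(2) \<open>x - m \<le> r\<close> by (intro mult_left_mono) auto
    also have "\<dots> \<le> tanh ((x - m) / 2)"
      using m(2) by (intro tanh_half_bounds) simp
    finally have lower: "(x - m) / 2 * (1 - r) \<le> tanh ((x - m) / 2)" .
    have "(x - Min A) / 2 * (1 - r) = (m - Min A) / 2 * (1 - r) + (x - m) / 2 * (1 - r)"
      by (simp add: field_simps)
    with lower w(3) w'(2)
    have "1 + (x - Min A) / 2 * (1 - r) \<le> (\<Sum>y\<in>insert x A. w' y)" by linarith
    moreover have "tanh ((x - m) / 2) \<le> (x - m) / 2"
      using m(2) by (intro tanh_half_bounds) simp
    with w(2) w'(2) have "(\<Sum>y\<in>insert x A. w' y) \<le> 1 + (x - Min A) / 2"
      by (simp add: field_simps)
    ultimately show ?thesis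
      unfolding eqs using w'(1) by blast
  qed
qed

text \<open>Both parameters along the segment are nonnegative, so the distance to \<open>a\<close>
  is the parameter times the length, without absolute value.\<close>

lemma dist_dist_closed_segment:
  fixes a b :: "'a::real_normed_vector"
  assumes "x \<in> closed_segment a b" "y \<in> closed_segment a b"
  shows "dist (dist a x) (dist a y) = dist x y"
proof -
  obtain s t where s: "0 \<le> s" "x = a + s *\<^sub>R (b - a)" and t: "0 \<le> t" "y = a + t *\<^sub>R (b - a)"
    using assms by (auto simp: in_segment algebra_simps)
  have "dist x y = \<bar>s - t\<bar> * norm (b - a)"
    unfolding s t by (simp add: dist_norm flip: scaleR_diff_left)
  then show ?thesis
    using s t by (simp add: dist_norm abs_mult flip: left_diff_distrib)
qed

lemma hausdorff_dist_lessD: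
  assumes "hausdorff_dist S A B < ereal e"
  shows "\<forall>x\<in>B. \<exists>y\<in>A. dist x y < e"
  using assms unfolding hausdorff_dist_def Inf_less_iff closed_nbhd_def
  by (auto simp: subset_iff) (meson le_less_trans)

text \<open>Gaps of at most \<open>2 * e\<close> cost at most \<open>e * dist a b\<close>, and
  missing up to \<open>e\<close> at each end costs \<open>e / 2\<close> twice.\<close>

lemma magnitude_near_segment:
  fixes a b :: "'a::euclidean_space"
  assumes "finite A" and sub: "A \<subseteq> closed_segment a b"
    and dense: "\<forall>x\<in>closed_segment a b. \<exists>y\<in>A. dist x y < e"
  shows "\<bar>magnitude A - (dist a b / 2 + 1)\<bar> \<le> e * (1 + dist a b)"
proof -
  define l T where "l = dist a b" and "T = dist a ` A"
  have T: "finite T" "T \<noteq> {}"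
    using assms by (auto simp: T_def)
  have range: "0 \<le> t \<and> t \<le> l" if "t \<in> T" for t
    using that sub dist_in_closed_segment(1)[of _ a b]
    by (auto simp: T_def l_def dist_commute)
  have near: "\<exists>s\<in>T. \<bar>t - s\<bar> < e" if t: "0 \<le> t" "t \<le> l" for t
  proof -
    have "\<exists>x\<in>closed_segment a b. dist a x = t"
    proof (cases "l = 0")
      case True
      then show ?thesis using t by force
    next
      case False
      then have "l > 0" by (simp add: l_def)
      have "dist a (a + (t / l) *\<^sub>R (b - a)) = t"
        using \<open>l > 0\<close> t by (simp add: dist_norm l_def norm_minus_commute)
      moreover have "a + (t / l) *\<^sub>R (b - a) \<in> closed_segment a b"
        unfolding in_segment using \<open>l > 0\<close> t
        by (intro exI[of _ "t / l"]) (auto simp: algebra_simps)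
      ultimately show ?thesis by blast
    qed
    then obtain x where x: "x \<in> closed_segment a b" "dist a x = t" by blast
    then obtain y where "y \<in> A" "dist x y < e" using dense by blast
    moreover from this have "dist x y = \<bar>t - dist a y\<bar>"
      using dist_dist_closed_segment[of x a b y] x sub by (auto simp: dist_real_def)
    ultimately show ?thesis by (auto simp: T_def)
  qed
  have "0 \<le> l" by (simp add: l_def)
  have "0 < e" using near[of 0] \<open>0 \<le> l\<close> by force
  \<comment> \<open>A point of \<open>T\<close> within \<open>e\<close> of \<open>x - e\<close> lies
    strictly between \<open>x - 2 * e\<close> and \<open>x\<close>. If \<open>x - e\<close> is not
    positive, \<open>Min T\<close> serves instead, since \<open>x - 2 * e\<close> is then
    negative.\<close>
  have "\<exists>y\<in>T. x - 2 * e \<le> y \<and> y < x" if x: "x \<in> T" "x \<noteq> Min T" for x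
  proof (cases "x \<le> e")
    case True
    moreover have "Min T < x"
      using Min_le[OF T(1) x(1)] x(2) by linarith
    ultimately show ?thesis
      using range[OF Min_in[OF T]] Min_in[OF T] \<open>0 < e\<close>
      by (intro bexI[of _ "Min T"]) linarith+
  next
    case False
    then obtain s where "s \<in> T" "\<bar>x - e - s\<bar> < e"
      using near[of "x - e"] range[OF x(1)] \<open>0 < e\<close> by auto
    then show ?thesis
      by (intro bexI[of _ s]) auto
  qed
  from weighting_bounds[OF T this] obtain w
    where w: "is_weighting T w" "(\<Sum>x\<in>T. w x) \<le> 1 + (Max T - Min T) / 2"
      "1 + (Max T - Min T) / 2 * (1 - 2 * e) \<le> (\<Sum>x\<in>T. w x)"
    by blast
  have iso: "\<And>x y. x \<in> A \<Longrightarrow> y \<in> A \<Longrightarrow> dist (dist a x) (dist a y) = dist x y"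
    using sub dist_dist_closed_segment by blast
  note isom = is_weighting_isometry[of A "dist a", OF iso, folded T_def]
  have mag: "magnitude A = (\<Sum>x\<in>T. w x)"
    using magnitude_eqI[of A "w \<circ> dist a"] isom(1)[of w] isom(2)[of w] w(1) by simp
  have "Max T - Min T \<le> l"
    using range[OF Min_in[OF T]] range[OF Max_in[OF T]] by linarith
  have "Min T \<le> e"
    using near[of 0] \<open>0 \<le> l\<close> Min_le[OF T(1)] by force
  moreover have "l - e \<le> Max T"
    using near[of l] \<open>0 \<le> l\<close> Max_ge[OF T(1)] by force
  moreover have "e * (Max T - Min T) \<le> e * l"
    using \<open>Max T - Min T \<le> l\<close> \<open>0 < e\<close> by simp
  ultimately have lower: "1 + l / 2 - e * (1 + l) \<le> 1 + (Max T - Min T) / 2 * (1 - 2 * e)"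
    by (simp add: field_simps)
  have "0 \<le> e * (1 + l)"
    using \<open>0 < e\<close> \<open>0 \<le> l\<close> by simp
  then show ?thesis
    using order.trans[OF lower w(3)] w(2) \<open>Max T - Min T \<le> l\<close>
    unfolding mag l_def[symmetric] abs_le_iff by (simp add: field_simps)
qed

theorem proposition6:
  fixes a b :: "'a::euclidean_space" and l :: real and X :: "nat \<Rightarrow> 'a set"
  assumes "l > 0"
    and "dist a b = l"
    and "\<And>k. k \<ge> 1 \<Longrightarrow> finite (X k)"
    and "\<And>k. k \<ge> 1 \<Longrightarrow> X k \<subseteq> closed_segment a b"
    and "(\<lambda>k. hausdorff_dist (closed_segment a b) (X k) (closed_segment a b)) \<longlonglongrightarrow> 0"
  shows "(\<lambda>k. magnitude (X k)) \<longlonglongrightarrow> l / 2 + 1"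
proof (rule tendstoI)
  fix \<epsilon> :: real assume "\<epsilon> > 0"
  \<comment> \<open>The factor 2 makes the final estimate strict: \<open>e * (1 + l)\<close> is half
    of \<open>\<epsilon>\<close>.\<close>
  define e where "e = \<epsilon> / (2 * (1 + l))"
  have e: "0 < e" "e * (1 + l) < \<epsilon>"
    using \<open>\<epsilon> > 0\<close> \<open>l > 0\<close> by (auto simp: e_def add_pos_pos field_simps)
  have "\<forall>\<^sub>F k in sequentially.
      hausdorff_dist (closed_segment a b) (X k) (closed_segment a b) < ereal e"
    using order_tendstoD(2)[OF assms(5), of "ereal e"] e by (simp add: zero_ereal_def)
  \<comment> \<open>The sequence starts at index 1, and \<open>X 0\<close> is arbitrary, so the
    index 0 is excluded explicitly.\<close>
  then show "\<forall>\<^sub>F k in sequentially. dist (magnitude (X k)) (l / 2 + 1) < \<epsilon>"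
    using eventually_ge_at_top[of 1]
  proof eventually_elim
    case (elim k)
    then have "\<bar>magnitude (X k) - (dist a b / 2 + 1)\<bar> \<le> e * (1 + dist a b)"
      by (intro magnitude_near_segment assms hausdorff_dist_lessD)
    then show ?case
      using e assms(2) by (simp add: dist_real_def)
  qed
qed

end
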